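(* Let $u_k:\mathbf{R}_{>0}\to\mathbf{R}_{>0}$ be a family of functions, indexed by integers $k\ge 1$, satisfying $\liminf_{x\to\infty}u_k(x)>0$ for all $k$. Assume that $$\frac{z\,u_k(y)}{u_k(yz)}\longrightarrow 0\quad\text{as } z\to\infty,\ \text{uniformly in } y\ge 1 \text{ (real) and } k\ge 1 \text{ (integer)}.$$ Consider a locally bounded function $f:\mathbf{R}_{>0}\to\mathbf{R}_{>0}$ and positive constants $c_1,c_2,x_0$ such that for all integers $k\ge 1$ and all real $x\ge x_0$, $$f(x)\le u_k(x)+c_1k\,f(c_2x/k).$$ Then for some constants $A,x_1$ and some integer $k\ge 1$ we have $f(x)\le A\,u_k(x)$ for all $x\ge x_1$.
   Context: $\mathbf{R}_{>0}$ is the set of positive real numbers; locally bounded means bounded on every compact subset of $\mathbf{R}_{>0}$. *)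

theory Defs
  imports "HOL-Analysis.Analysis"
begin

definition locally_bounded :: "(real \<Rightarrow> real) \<Rightarrow> bool" where
  "locally_bounded f \<longleftrightarrow> (\<forall>K. compact K \<and> K \<subseteq> {0<..} \<longrightarrow> bounded (f ` K))"

end

theory Submission
  imports Defs
begin

text \<open>
  Uniformity in \<open>k\<close> allows fixing one \<open>k\<close> so large that, with \<open>z = k / c2 > 1\<close>,
  \<open>c1 * k * u k (x / z) \<le> u k x / 2\<close> whenever \<open>x \<ge> z\<close>. A bound \<open>f \<le> A * u k\<close> with
  \<open>A \<ge> 2\<close> then propagates from \<open>x / z\<close> to \<open>x\<close>, because \<open>1 + A / 2 \<le> A\<close>. It starts on
  a compact interval \<open>[X, X * z]\<close>, where \<open>f\<close> is bounded and \<open>u k\<close> is bounded below.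
\<close>

text \<open>Repeated division by \<open>z\<close> brings every \<open>x \<ge> a\<close> into
  \<open>[a, a * z]\<close>, and an \<open>n\<close> with \<open>x \<le> a * z ^ n\<close> bounds
  the number of divisions. Dividing only when \<open>x > a * z\<close> keeps the quotient at least
  \<open>a\<close>.\<close>

lemma multiplicative_induct:
  fixes a z x :: real
  assumes "z > 1" and "a > 0" and "x \<ge> a"
    and base: "\<And>x. a \<le> x \<Longrightarrow> x \<le> a * z \<Longrightarrow> P x"
    and step: "\<And>x. a * z \<le> x \<Longrightarrow> P (x / z) \<Longrightarrow> P x"
  shows "P x"
proof -
  obtain n where "x / a < z ^ n"
    using real_arch_pow[OF \<open>z > 1\<close>] by blast
  with \<open>a > 0\<close> have "x \<le> a * z ^ n"
    by (simp add: field_simps)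
  with \<open>x \<ge> a\<close> show ?thesis
  proof (induction n arbitrary: x)
    case 0
    with \<open>z > 1\<close> \<open>a > 0\<close> show ?case
      by (intro base) (auto intro: order_trans)
  next
    case (Suc n)
    show ?case
    proof (cases "x \<le> a * z")
      case True
      with Suc.prems show ?thesis
        by (intro base)
    next
      case False
      with Suc.prems \<open>z > 1\<close> have "a \<le> x / z" "x / z \<le> a * z ^ n"
        by (simp_all add: field_simps)
      with Suc.IH False show ?thesis
        by (auto intro: step[of x])
    qed
  qed
qed

theorem lemma4p1:
  fixes u :: "nat \<Rightarrow> real \<Rightarrow> real" and f :: "real \<Rightarrow> real" and c1 c2 x0 :: real
  assumes "\<And>k. k \<ge> 1 \<Longrightarrow> u k \<in> {0<..} \<rightarrow> {0<..}"
    and "\<And>k. k \<ge> 1 \<Longrightarrow> Liminf at_top (\<lambda>x. ereal (u k x)) > 0"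
    and "uniform_limit ({1..} \<times> {1..}) (\<lambda>z (y, k). z * u k y / u k (y * z)) (\<lambda>_. 0) at_top"
    and "f \<in> {0<..} \<rightarrow> {0<..}"
    and "locally_bounded f"
    and "c1 > 0" and "c2 > 0" and "x0 > 0"
    and "\<And>k x. k \<ge> 1 \<Longrightarrow> x \<ge> x0 \<Longrightarrow> f x \<le> u k x + c1 * real k * f (c2 * x / real k)"
  shows "\<exists>(A::real) (x1::real) (k::nat). k \<ge> 1 \<and> (\<forall>x. x > 0 \<and> x \<ge> x1 \<longrightarrow> f x \<le> A * u k x)"
proof -
  \<comment> \<open>With \<open>real k = c2 * z\<close>, the product
    \<open>c1 * real k * u k (x / z)\<close> is \<open>c1 * c2\<close> times
    \<open>z * u k (x / z)\<close>; this \<epsilon> turns the limit into the factor 1/2.\<close>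
  define \<epsilon> where "\<epsilon> = 1 / (2 * c1 * c2)"
  have "\<epsilon> > 0"
    using assms(6,7) by (simp add: \<epsilon>_def)
  \<comment> \<open>\<open>Z\<close> serves all \<open>k\<close> at once, so \<open>k\<close> may be
    chosen after it, although \<open>z\<close> will depend on \<open>k\<close>.\<close>
  from uniform_limitD[OF assms(3) this]
  obtain Z where Z: "\<And>z y k. z \<ge> Z \<Longrightarrow> y \<ge> 1 \<Longrightarrow> k \<ge> 1 \<Longrightarrow> \<bar>z * u k y / u k (y * z)\<bar> < \<epsilon>"
    unfolding eventually_at_top_linorder by fastforce
  obtain k :: nat where k: "real k > c2 * max 1 Z"
    using reals_Archimedean2 by blast
  define z where "z = real k / c2"
  have z: "z > 1" "z \<ge> Z"
    using k \<open>c2 > 0\<close> by (simp_all add: z_def less_divide_eq le_divide_eq max_mult_distrib_left mult.commute)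
  have "k \<ge> 1"
    using z(1) by (cases k) (auto simp: z_def)
  have u_pos: "u k x > 0" if "x > 0" for x
    using assms(1)[OF \<open>k \<ge> 1\<close>] that by auto
  have contract: "c1 * real k * u k (x / z) \<le> u k x / 2" if "x \<ge> z" for x
  proof -
    \<comment> \<open>Uniformity is used at \<open>y = x / z\<close>, which is at least 1 since
      \<open>x \<ge> z\<close>.\<close>
    have "z * u k (x / z) / u k x < \<epsilon>"
      using le_less_trans[OF abs_ge_self Z, of z "x / z" k] that z \<open>k \<ge> 1\<close> by simp
    then have "z * u k (x / z) < \<epsilon> * u k x"
      using u_pos[of x] that z by (simp add: field_simps)
    then show ?thesis
      using assms(6,7) by (simp add: z_def \<epsilon>_def field_simps)
  qed
  \<comment> \<open>The lower limit may be infinite, so a real number strictly between 0 and it is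
    taken.\<close>
  obtain \<delta> where \<delta>: "0 < ereal \<delta>" "ereal \<delta> < Liminf at_top (\<lambda>x. ereal (u k x))"
    using ereal_dense2[OF assms(2)[OF \<open>k \<ge> 1\<close>]] by blast
  have "eventually (\<lambda>x. \<delta> < u k x) at_top"
    using less_LiminfD[OF \<delta>(2)] by simp
  then obtain X0 where X0: "\<And>x. x \<ge> X0 \<Longrightarrow> \<delta> < u k x"
    by (auto simp: eventually_at_top_linorder)
  \<comment> \<open>The 1 keeps \<open>[X, X * z]\<close> inside the positive reals and gives
    \<open>X * z \<ge> z\<close>, so that \<open>contract\<close> applies beyond
    \<open>X * z\<close>; \<open>x0\<close> allows the recursive inequality, and \<open>X0\<close>
    the bound by \<delta>.\<close>
  define X where "X = max (max 1 x0) X0"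
  have X: "X \<ge> 1" "X \<ge> x0" "X \<ge> X0"
    by (auto simp: X_def)
  have "bounded (f ` {X..X * z})"
    using assms(5) X(1) unfolding locally_bounded_def by (elim allE impE) auto
  then obtain M where M: "\<And>x. x \<in> {X..X * z} \<Longrightarrow> \<bar>f x\<bar> \<le> M"
    unfolding bounded_iff real_norm_def by blast
  \<comment> \<open>\<open>M / \<delta>\<close> settles the initial interval, 2 the
    propagation.\<close>
  define A where "A = max 2 (M / \<delta>)"
  have "A \<ge> 2" "M \<le> A * \<delta>"
    using \<delta>(1) by (simp_all add: A_def flip: pos_divide_le_eq)
  have "f x \<le> A * u k x" if "x \<ge> X" for x
    using z(1) _ that
  proof (rule multiplicative_induct)
    show "X > 0"
      using X(1) by simp
  next
    fix x assume x: "X \<le> x" "x \<le> X * z"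
    have "f x \<le> M"
      using M[of x] x by simp
    also have "M \<le> A * \<delta>" by fact
    also have "\<dots> \<le> A * u k x"
      using X0[of x] x X(3) \<open>A \<ge> 2\<close> by (intro mult_left_mono) auto
    finally show "f x \<le> A * u k x" .
  next
    fix x assume x: "X * z \<le> x" and IH: "f (x / z) \<le> A * u k (x / z)"
    have "z \<le> X * z" "X \<le> X * z"
      using X(1) z(1) by auto
    with x have x': "x \<ge> z" "x \<ge> X"
      by linarith+
    \<comment> \<open>The argument \<open>c2 * x / real k\<close> is exactly
      \<open>x / z\<close>.\<close>
    have "f x \<le> u k x + c1 * real k * f (x / z)"
      using assms(9)[OF \<open>k \<ge> 1\<close>, of x] x' X(2) by (simp add: z_def mult.commute)
    also have "\<dots> \<le> u k x + c1 * real k * (A * u k (x / z))"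
      using IH \<open>c1 > 0\<close> by (intro add_left_mono mult_left_mono) auto
    also have "\<dots> = u k x + A * (c1 * real k * u k (x / z))"
      by (simp add: mult_ac)
    also have "\<dots> \<le> u k x + A * (u k x / 2)"
      using contract[OF x'(1)] \<open>A \<ge> 2\<close> by (intro add_left_mono mult_left_mono) auto
    also have "\<dots> \<le> A * u k x"
    proof -
      have "2 * u k x \<le> A * u k x"
        using \<open>A \<ge> 2\<close> u_pos[of x] x' X(1) by (intro mult_right_mono) auto
      then show ?thesis by simp
    qed
    finally show "f x \<le> A * u k x" .
  qed
  with \<open>k \<ge> 1\<close> show ?thesis by blast
qed

end
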